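(* Two $B$-terms are $\beta\eta$-equivalent if and only if their equality is derivable (in equational logic, i.e. using reflexivity, symmetry, transitivity, congruence with respect to application, and instantiation of the variables $x,y,z$ by arbitrary $B$-terms) from the following three equations: \[ B\,x\,y\,z = x\,(y\,z) \quad\text{(B1)},\qquad B\,(B\,x\,y) = B\,(B\,x)\,(B\,y) \quad\text{(B2)},\qquad B\,B\,(B\,x) = B\,(B\,(B\,x))\,B \quad\text{(B3)}. \]
   Context: $B$ denotes the combinator $\lambda f.\lambda g.\lambda x.\, f\,(g\,x)$. A $B$-term is a combinatory term built from the constant $B$ alone by application (application is left-associative). Two $B$-terms are called equivalent ($\beta\eta$-equivalent) if the $\lambda$-terms obtained by replacing each $B$ by $\lambda f.\lambda g.\lambda x.\, f\,(g\,x)$ are $\beta\eta$-equivalent. *)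

theory Defs
  imports Main
begin

section \<open>Lambda terms and beta-eta-equivalence\<close>

text \<open>Untyped lambda terms in de Bruijn notation; indices start at 0.\<close>

datatype lam = LVar nat | LApp lam lam | LAbs lam

primrec lift :: "lam \<Rightarrow> nat \<Rightarrow> lam" where
  "lift (LVar i) k = (if i < k then LVar i else LVar (Suc i))"
| "lift (LApp s t) k = LApp (lift s k) (lift t k)"
| "lift (LAbs s) k = LAbs (lift s (Suc k))"

text \<open>\<open>subst t s k\<close> replaces index \<open>k\<close> in \<open>t\<close> by \<open>s\<close> and lowers the indices above \<open>k\<close>, since
  it is used where the binder of \<open>k\<close> disappears.\<close>

primrec subst :: "lam \<Rightarrow> lam \<Rightarrow> nat \<Rightarrow> lam" where
  "subst (LVar i) s k = (if k < i then LVar (i - 1) else if i = k then s else LVar i)"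
| "subst (LApp t u) s k = LApp (subst t s k) (subst u s k)"
| "subst (LAbs t) s k = LAbs (subst t (lift s 0) (Suc k))"

text \<open>In \<open>eta\<close>, the lift expresses that the bound variable does not occur free in \<open>t\<close>.\<close>

inductive beta_eta_eq :: "lam \<Rightarrow> lam \<Rightarrow> bool" (infix "=\<^sub>\<beta>\<^sub>\<eta>" 50) where
  beta: "LApp (LAbs t) s =\<^sub>\<beta>\<^sub>\<eta> subst t s 0"
| eta: "LAbs (LApp (lift t 0) (LVar 0)) =\<^sub>\<beta>\<^sub>\<eta> t"
| refl: "t =\<^sub>\<beta>\<^sub>\<eta> t"
| sym: "s =\<^sub>\<beta>\<^sub>\<eta> t \<Longrightarrow> t =\<^sub>\<beta>\<^sub>\<eta> s"
| trans: "s =\<^sub>\<beta>\<^sub>\<eta> t \<Longrightarrow> t =\<^sub>\<beta>\<^sub>\<eta> u \<Longrightarrow> s =\<^sub>\<beta>\<^sub>\<eta> u"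
| app: "s =\<^sub>\<beta>\<^sub>\<eta> s' \<Longrightarrow> t =\<^sub>\<beta>\<^sub>\<eta> t' \<Longrightarrow> LApp s t =\<^sub>\<beta>\<^sub>\<eta> LApp s' t'"
| abs: "s =\<^sub>\<beta>\<^sub>\<eta> t \<Longrightarrow> LAbs s =\<^sub>\<beta>\<^sub>\<eta> LAbs t"

section \<open>B-terms\<close>

datatype bterm = B | BApp bterm bterm (infixl "\<cdot>" 200)

text \<open>The image of \<^const>\<open>B\<close> is \<open>\<lambda>f. \<lambda>g. \<lambda>x. f (g x)\<close>.\<close>

primrec to_lam :: "bterm \<Rightarrow> lam" where
  "to_lam B = LAbs (LAbs (LAbs (LApp (LVar 2) (LApp (LVar 1) (LVar 0)))))"
| "to_lam (s \<cdot> t) = LApp (to_lam s) (to_lam t)"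

definition B_equivalent :: "bterm \<Rightarrow> bterm \<Rightarrow> bool" where
  "B_equivalent s t \<longleftrightarrow> to_lam s =\<^sub>\<beta>\<^sub>\<eta> to_lam t"

text \<open>The variables \<open>x\<close>, \<open>y\<close>, \<open>z\<close> of the three equations range over all B-terms, so the rules
  \<open>B1\<close>, \<open>B2\<close>, \<open>B3\<close> comprise the instantiation rule of equational logic.\<close>

inductive B_derivable :: "bterm \<Rightarrow> bterm \<Rightarrow> bool" where
  B1: "B_derivable (B \<cdot> x \<cdot> y \<cdot> z) (x \<cdot> (y \<cdot> z))"
| B2: "B_derivable (B \<cdot> (B \<cdot> x \<cdot> y)) (B \<cdot> (B \<cdot> x) \<cdot> (B \<cdot> y))"
| B3: "B_derivable (B \<cdot> B \<cdot> (B \<cdot> x)) (B \<cdot> (B \<cdot> (B \<cdot> x)) \<cdot> B)"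
| refl: "B_derivable t t"
| sym: "B_derivable s t \<Longrightarrow> B_derivable t s"
| trans: "B_derivable s t \<Longrightarrow> B_derivable t u \<Longrightarrow> B_derivable s u"
| cong: "B_derivable s s' \<Longrightarrow> B_derivable t t' \<Longrightarrow> B_derivable (s \<cdot> t) (s' \<cdot> t')"

end

(*
  Write e(n) for B (B (... (B B))) with n outer B's and f o g for B f g. By (B1) and (B2), o is
  associative and B (f o g) = B f o B g, and (B3) gives e(m) o e(n) = e(n+1) o e(m) for m < n.
  Hence every B-term is derivably equal to some e(n1) o ... o e(nk) with n1 >= ... >= nk and k >= 1.
  Conversely, e(n) x u0 u1 ... reduces to x u0 ... (un u(n+1)) ..., so applying such a product to
  sufficiently many variables yields a forest of binary trees. These applicative terms are
  beta-eta-normal, so by confluence beta-eta-equivalent products produce the same forest, and the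
  forest determines the decreasing sequence n1, ..., nk.
*)

theory Submission
  imports Defs "HOL-Library.Confluence"
begin

section \<open>Parallel beta-eta-reduction\<close>

lemma lift_lift: "i \<le> k \<Longrightarrow> lift (lift t i) (Suc k) = lift (lift t k) i"
  by (induction t arbitrary: i k) auto

lemma subst_lift [simp]: "subst (lift t k) s k = t"
  by (induction t arbitrary: k s) auto

lemma lift_subst_above:
  "j \<le> i \<Longrightarrow> lift (subst t s j) i = subst (lift t (Suc i)) (lift s i) j"
  by (induction t arbitrary: i j s) (auto simp: lift_lift)

lemma lift_subst_below:
  "i \<le> j \<Longrightarrow> lift (subst t s j) i = subst (lift t i) (lift s i) (Suc j)"
  by (induction t arbitrary: i j s) (auto simp: lift_lift)

text \<open>The substitution lemma. Here \<open>t\<close> has one variable more than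
  \<open>u\<close>, the one removed by the substitution at \<open>i\<close>; so inside
  \<open>t\<close> the term \<open>v\<close> is lifted and \<open>j\<close> raised.\<close>

lemma subst_subst:
  "i \<le> j \<Longrightarrow> subst (subst t (lift v i) (Suc j)) (subst u v j) i = subst (subst t u i) v j"
  by (induction t arbitrary: i j u v)
    (auto simp: lift_lift [symmetric] lift_subst_below)

lemma lift_inject [simp]: "lift s k = lift t k \<longleftrightarrow> s = t"
  by (metis subst_lift)

lemma size_lift [simp]: "size (lift t k) = size t"
  by (induction t arbitrary: k) auto

lemma lift_eq_LVar: "lift t (Suc k) = LVar 0 \<longleftrightarrow> t = LVar 0"
  by (cases t) auto

lemma lift_eq_LApp:
  "lift t k = LApp u v \<longleftrightarrow> (\<exists>a b. t = LApp a b \<and> lift a k = u \<and> lift b k = v)"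
  by (cases t) auto

lemma lift_eq_LAbs: "lift t k = LAbs u \<longleftrightarrow> (\<exists>a. t = LAbs a \<and> lift a (Suc k) = u)"
  by (cases t) auto

text \<open>A converse of \<open>lift_lift\<close>: a term omitting two variables is a double lift.
  It is used where an eta-redex is itself a lifted term.\<close>

lemma lift_eq_lift:
  "lift a (Suc k) = lift w i \<Longrightarrow> i \<le> k \<Longrightarrow> \<exists>c. a = lift c i \<and> w = lift c k"
proof (induction a arbitrary: w i k)
  case (LVar x)
  then obtain y where w: "w = LVar y"
    by (cases w) (auto split: if_splits)
  \<comment> \<open>\<open>x = i\<close> is impossible, as a lift at \<open>i\<close> never produces
    index \<open>i\<close>; the witness closes the gap left there.\<close>
  show ?case
    by (rule exI [of _ "LVar (if x < i then x else x - 1)"])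
      (use LVar w in \<open>auto split: if_splits\<close>)
next
  case (LApp a1 a2)
  then obtain w1 w2 where w: "w = LApp w1 w2"
    by (cases w) (auto split: if_splits)
  with LApp.prems LApp.IH [of k w1 i] LApp.IH [of k w2 i]
  obtain c1 c2 where "a1 = lift c1 i" "w1 = lift c1 k" "a2 = lift c2 i" "w2 = lift c2 k"
    by auto
  with w show ?case
    by (intro exI [of _ "LApp c1 c2"]) auto
next
  case (LAbs a)
  then obtain w1 where w: "w = LAbs w1"
    by (cases w) (auto split: if_splits)
  with LAbs.prems LAbs.IH [of "Suc k" w1 "Suc i"]
  obtain c where "a = lift c (Suc i)" "w1 = lift c (Suc k)"
    by auto
  with w show ?case
    by (intro exI [of _ "LAbs c"]) auto
qed

section \<open>Parallel reduction and its diamond property\<close>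

inductive par :: "lam \<Rightarrow> lam \<Rightarrow> bool" (infix "\<Rrightarrow>" 50) where
  var: "LVar i \<Rrightarrow> LVar i"
| app: "s \<Rrightarrow> s' \<Longrightarrow> t \<Rrightarrow> t' \<Longrightarrow> LApp s t \<Rrightarrow> LApp s' t'"
| abs: "s \<Rrightarrow> s' \<Longrightarrow> LAbs s \<Rrightarrow> LAbs s'"
| beta: "s \<Rrightarrow> s' \<Longrightarrow> t \<Rrightarrow> t' \<Longrightarrow> LApp (LAbs s) t \<Rrightarrow> subst s' t' 0"
| eta: "s \<Rrightarrow> s' \<Longrightarrow> LAbs (LApp (lift s 0) (LVar 0)) \<Rrightarrow> s'"

inductive_cases par_LVarE: "LVar i \<Rrightarrow> t"

lemma par_LAppE [consumes 1, case_names app beta]: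
  assumes "LApp s t \<Rrightarrow> u"
  obtains s' t' where "u = LApp s' t'" "s \<Rrightarrow> s'" "t \<Rrightarrow> t'"
  | r r' t' where "s = LAbs r" "u = subst r' t' 0" "r \<Rrightarrow> r'" "t \<Rrightarrow> t'"
  using assms by cases auto

lemma par_LAbsE [consumes 1, case_names abs eta]:
  assumes "LAbs s \<Rrightarrow> u"
  obtains s' where "u = LAbs s'" "s \<Rrightarrow> s'"
  | r where "s = LApp (lift r 0) (LVar 0)" "r \<Rrightarrow> u"
  using assms by cases auto

lemma par_refl [simp]: "t \<Rrightarrow> t"
  by (induction t) (auto intro: par.intros)

lemma par_lift: "s \<Rrightarrow> t \<Longrightarrow> lift s k \<Rrightarrow> lift t k"
  by (induction arbitrary: k rule: par.induct)
    (auto simp: lift_subst_above lift_lift intro: par.intros)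

lemma par_subst: "s \<Rrightarrow> s' \<Longrightarrow> t \<Rrightarrow> t' \<Longrightarrow> subst s t k \<Rrightarrow> subst s' t' k"
proof (induction arbitrary: t t' k rule: par.induct)
  case (beta a a' b b')
  have "LApp (LAbs (subst a (lift t 0) (Suc k))) (subst b t k)
    \<Rrightarrow> subst (subst a' (lift t' 0) (Suc k)) (subst b' t' k) 0"
    by (intro par.beta beta.IH par_lift beta.prems)
  then show ?case
    by (simp add: subst_subst)
next
  case (eta a a')
  then show ?case
    by (auto simp: lift_subst_below [symmetric] intro: par.intros)
next
  case (abs s s')
  then show ?case
    by (simp add: par.abs par_lift)
qed (auto intro: par.intros)

text \<open>Reduction creates no free variables. Hence reducing the function part of an eta-redex
  keeps its freshness condition.\<close>

lemma par_lift_inv: "lift t k \<Rrightarrow> s \<Longrightarrow> \<exists>s'. s = lift s' k \<and> t \<Rrightarrow> s'"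
proof (induction "lift t k" s arbitrary: t k rule: par.induct)
  case (var i)
  then show ?case
    by (metis par_refl)
next
  case (app a a' b b')
  then obtain t1 t2 where "t = LApp t1 t2" "a = lift t1 k" "b = lift t2 k"
    by (metis lift_eq_LApp)
  with app show ?case
    by (metis lift.simps(2) par.app)
next
  case (abs a a')
  then obtain t1 where "t = LAbs t1" "a = lift t1 (Suc k)"
    by (metis lift_eq_LAbs)
  with abs show ?case
    by (metis lift.simps(3) par.abs)
next
  case (beta a a' b b')
  then obtain t1 t2 where t: "t = LApp (LAbs t1) t2" "a = lift t1 (Suc k)" "b = lift t2 k"
    by (metis lift_eq_LApp lift_eq_LAbs)
  with beta obtain c1 c2 where "a' = lift c1 (Suc k)" "t1 \<Rrightarrow> c1" "b' = lift c2 k" "t2 \<Rrightarrow> c2"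
    by metis
  with t show ?case
    by (intro exI [of _ "subst c1 c2 0"]) (auto simp: lift_subst_above intro: par.intros)
next
  case (eta a a')
  then obtain t1 where t: "t = LAbs (LApp t1 (LVar 0))" "lift t1 (Suc k) = lift a 0"
    by (auto dest!: HOL.sym [of "LAbs _"] simp: lift_eq_LApp lift_eq_LAbs lift_eq_LVar)
  then obtain c where c: "t1 = lift c 0" "a = lift c k"
    using lift_eq_lift by blast
  with eta t show ?case
    by (metis par.eta)
qed

text \<open>For \<open>k = 0\<close> this is the beta step inside
  \<open>\<lambda>x. (\<lambda>y. t) x\<close>: its result agrees with that of the eta step.\<close>

lemma subst_lift_Suc_LVar [simp]: "subst (lift t (Suc k)) (LVar k) k = t"
  by (induction t arbitrary: k) auto

text \<open>The induction is on size because the function part of an eta-redex is a subterm only up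
  to lifting, which preserves size. The local facts \<open>beta_app\<close> and
  \<open>abs_eta\<close> treat a contraction against a reduction of the parts, each serving two
  symmetric cases.\<close>

lemma par_diamond: "t \<Rrightarrow> u \<Longrightarrow> t \<Rrightarrow> v \<Longrightarrow> \<exists>w. u \<Rrightarrow> w \<and> v \<Rrightarrow> w"
proof (induction t arbitrary: u v rule: measure_induct_rule [of size])
  case (less t)
  have beta_app: "\<exists>w. subst s' p 0 \<Rrightarrow> w \<and> LApp r q \<Rrightarrow> w"
    if t: "t = LApp (LAbs s) b" and s': "s \<Rrightarrow> s'" and b: "b \<Rrightarrow> p" "b \<Rrightarrow> q" and "LAbs s \<Rrightarrow> r"
    for s b s' p q r
  proof -
    obtain b' where b': "p \<Rrightarrow> b'" "q \<Rrightarrow> b'"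
      using less.IH [of b p q] b by (auto simp: t)
    from \<open>LAbs s \<Rrightarrow> r\<close> show ?thesis
    proof (cases rule: par_LAbsE)
      case abs1: (abs s'')
      then obtain w where "s' \<Rrightarrow> w" "s'' \<Rrightarrow> w"
        using less.IH [of s s' s''] s' by (auto simp: t)
      with abs1 b' show ?thesis
        by (auto intro: par_subst par.beta)
    next
      case eta1: (eta a)
      \<comment> \<open>The eta step on the function is replayed in the body \<open>s\<close>, to
        which the induction hypothesis applies; substituting \<open>q\<close> for the bound variable
        then recovers \<open>LApp r q\<close>.\<close>
      then have "s \<Rrightarrow> LApp (lift r 0) (LVar 0)"
        by (auto intro: par.app par_lift)
      then obtain w where w: "s' \<Rrightarrow> w" "LApp (lift r 0) (LVar 0) \<Rrightarrow> w"
        using less.IH [of s s' "LApp (lift r 0) (LVar 0)"] s' by (auto simp: t)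
      from par_subst [OF this(2) b'(2), of 0] have "LApp r q \<Rrightarrow> subst w b' 0"
        by simp
      with w b' show ?thesis
        by (blast intro: par_subst)
    qed
  qed
  have abs_eta: "\<exists>w. LAbs s' \<Rrightarrow> w \<and> r \<Rrightarrow> w"
    if t: "t = LAbs (LApp (lift a 0) (LVar 0))" and s': "LApp (lift a 0) (LVar 0) \<Rrightarrow> s'"
      and r: "a \<Rrightarrow> r" for a s' r
  proof -
    have IH: "\<exists>w. c \<Rrightarrow> w \<and> r \<Rrightarrow> w" if "a \<Rrightarrow> c" for c
      using less.IH [of a c r] r that by (simp add: t)
    from s' show ?thesis
    proof (cases rule: par_LAppE)
      case app1: (app c d)
      then obtain c' where "c = lift c' 0" "a \<Rrightarrow> c'" "d = LVar 0"
        using par_lift_inv by (blast elim: par_LVarE)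
      with app1 IH show ?thesis
        by (metis par.eta)
    next
      case beta1: (beta c c' d)
      then obtain a1 where a1: "a = LAbs a1" "c = lift a1 (Suc 0)"
        by (metis lift_eq_LAbs)
      then obtain a2 where "c' = lift a2 (Suc 0)" "a1 \<Rrightarrow> a2"
        using beta1 par_lift_inv by blast
      moreover have "d = LVar 0"
        using beta1 by (blast elim: par_LVarE)
      ultimately have "s' = a2" "a \<Rrightarrow> LAbs a2"
        using beta1 a1 by (auto intro: par.abs)
      with IH show ?thesis
        by blast
    qed
  qed
  from less.prems(1) show ?case
  proof cases
    case (var i)
    with less.prems show ?thesis
      by (metis par_LVarE par_refl)
  next
    case (app a a' b b')
    from less.prems(2) [unfolded app] show ?thesis
    proof (cases rule: par_LAppE)
      case app1: (app a'' b'')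
      then show ?thesis
        using less.IH [unfolded app, of a a' a''] less.IH [unfolded app, of b b' b''] app
        by (auto intro: par.app)
    next
      case beta1: (beta s s' p)
      with app beta_app [of s b s' p b' a'] show ?thesis
        by auto
    qed
  next
    case (abs s s')
    from less.prems(2) [unfolded abs] show ?thesis
    proof (cases rule: par_LAbsE)
      case abs1: (abs s'')
      then show ?thesis
        using less.IH [unfolded abs, of s s' s''] abs by (auto intro: par.abs)
    next
      case eta1: (eta a)
      with abs abs_eta [of a s' v] show ?thesis
        by auto
    qed
  next
    case (beta s s' b p)
    from less.prems(2) [unfolded beta] show ?thesis
    proof (cases rule: par_LAppE)
      case app1: (app r q)
      with beta beta_app [of s b s' p q r] show ?thesis
        by auto
    next
      case beta1: (beta s1 s'' q)
      then have "s \<Rrightarrow> s''" by simp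
      with beta1 show ?thesis
        using less.IH [unfolded beta, of s s' s''] less.IH [unfolded beta, of b p q] beta
        by (auto intro: par_subst)
    qed
  next
    case (eta a)
    from less.prems(2) [unfolded eta] show ?thesis
    proof (cases rule: par_LAbsE)
      case abs1: (abs s')
      with eta abs_eta [of a s' u] show ?thesis
        by auto
    next
      case eta1: (eta c)
      then show ?thesis
        using less.IH [unfolded eta, of a u v] eta by auto
    qed
  qed
qed

section \<open>Confluence and uniqueness of abstraction-free normal forms\<close>

lemma confluentp_par: "confluentp par"
  by (rule strong_confluentp_imp_confluentp, rule strong_confluentpI) (use par_diamond in blast)

lemma pars_app: "par\<^sup>*\<^sup>* s s' \<Longrightarrow> par\<^sup>*\<^sup>* t t' \<Longrightarrow> par\<^sup>*\<^sup>* (LApp s t) (LApp s' t')"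
proof (induction rule: rtranclp_induct)
  case base
  then show ?case
    by (induction rule: rtranclp_induct) (auto intro: par.app par_refl rtranclp.rtrancl_into_rtrancl)
next
  case (step y z)
  then show ?case
    by (metis par.app par_refl rtranclp.rtrancl_into_rtrancl)
qed

lemma pars_abs: "par\<^sup>*\<^sup>* s s' \<Longrightarrow> par\<^sup>*\<^sup>* (LAbs s) (LAbs s')"
  by (induction rule: rtranclp_induct) (auto intro: par.abs rtranclp.rtrancl_into_rtrancl)

text \<open>The Church-Rosser property; confluence enters for transitivity, closing the peak at the
  middle term.\<close>

lemma beta_eta_eq_joinable: "s =\<^sub>\<beta>\<^sub>\<eta> t \<Longrightarrow> \<exists>u. par\<^sup>*\<^sup>* s u \<and> par\<^sup>*\<^sup>* t u"
proof (induction rule: beta_eta_eq.induct)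
  case (beta t s)
  then show ?case
    by (meson par.beta par_refl r_into_rtranclp rtranclp.rtrancl_refl)
next
  case (eta t)
  then show ?case
    by (meson par.eta par_refl r_into_rtranclp rtranclp.rtrancl_refl)
next
  case (trans s t u)
  then obtain v w where "par\<^sup>*\<^sup>* s v" "par\<^sup>*\<^sup>* t v" "par\<^sup>*\<^sup>* t w" "par\<^sup>*\<^sup>* u w"
    by blast
  then show ?case
    using confluentpD [OF confluentp_par] by (meson rtranclp_trans)
qed (blast intro: pars_app pars_abs)+

text \<open>Both kinds of redex contain an abstraction, so this is a simple sufficient condition for
  normality, and the forests satisfy it.\<close>

primrec abs_free :: "lam \<Rightarrow> bool" where
  "abs_free (LVar i) \<longleftrightarrow> True"
| "abs_free (LApp s t) \<longleftrightarrow> abs_free s \<and> abs_free t"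
| "abs_free (LAbs s) \<longleftrightarrow> False"

lemma par_abs_free: "s \<Rrightarrow> t \<Longrightarrow> abs_free s \<Longrightarrow> t = s"
  by (induction rule: par.induct) auto

lemma pars_abs_free: "par\<^sup>*\<^sup>* s t \<Longrightarrow> abs_free s \<Longrightarrow> t = s"
  by (induction rule: rtranclp_induct) (auto dest: par_abs_free)

lemma beta_eta_eq_abs_free: "s =\<^sub>\<beta>\<^sub>\<eta> t \<Longrightarrow> abs_free s \<Longrightarrow> abs_free t \<Longrightarrow> s = t"
  by (metis beta_eta_eq_joinable pars_abs_free)

section \<open>Soundness of the equations\<close>

lemma lift_to_lam [simp]: "lift (to_lam s) k = to_lam s"
  by (induction s arbitrary: k) auto

text \<open>Abstracting the fresh variable and contracting by eta on both sides gives
  extensionality.\<close>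

lemma beta_eta_eq_ext:
  assumes "LApp (lift s 0) (LVar 0) =\<^sub>\<beta>\<^sub>\<eta> LApp (lift t 0) (LVar 0)"
  shows "s =\<^sub>\<beta>\<^sub>\<eta> t"
  by (meson assms beta_eta_eq.abs beta_eta_eq.eta beta_eta_eq.sym beta_eta_eq.trans)

lemma to_lam_B_app: "LApp (LApp (LApp (to_lam B) f) g) x =\<^sub>\<beta>\<^sub>\<eta> LApp f (LApp g x)"
proof -
  have "LApp (to_lam B) f =\<^sub>\<beta>\<^sub>\<eta>
      LAbs (LAbs (LApp (lift (lift f 0) 0) (LApp (LVar 1) (LVar 0))))"
    using beta_eta_eq.beta [of "LAbs (LAbs (LApp (LVar 2) (LApp (LVar 1) (LVar 0))))" f]
    by (simp add: numeral_2_eq_2)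
  moreover have "LApp (LAbs (LAbs (LApp (lift (lift f 0) 0) (LApp (LVar 1) (LVar 0))))) g
      =\<^sub>\<beta>\<^sub>\<eta> LAbs (LApp (lift f 0) (LApp (lift g 0) (LVar 0)))"
    using beta_eta_eq.beta [of "LAbs (LApp (lift (lift f 0) 0) (LApp (LVar 1) (LVar 0)))" g]
    by (simp add: lift_lift [symmetric])
  moreover have "LApp (LAbs (LApp (lift f 0) (LApp (lift g 0) (LVar 0)))) x
      =\<^sub>\<beta>\<^sub>\<eta> LApp f (LApp g x)"
    using beta_eta_eq.beta [of "LApp (lift f 0) (LApp (lift g 0) (LVar 0))" x]
    by simp
  ultimately show ?thesis
    by (meson beta_eta_eq.app beta_eta_eq.refl beta_eta_eq.trans)
qed

text \<open>After two further arguments \<open>g\<close> and \<open>z\<close>, both sides reduce to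
  \<open>x (y (g z))\<close>. Arbitrary lambda terms are allowed so that the law also serves for B3
  under a fresh variable.\<close>

lemma to_lam_B_comp:
  "LApp (to_lam B) (LApp (LApp (to_lam B) x) y)
    =\<^sub>\<beta>\<^sub>\<eta> LApp (LApp (to_lam B) (LApp (to_lam B) x)) (LApp (to_lam B) y)"
proof -
  \<comment> \<open>Generality in \<open>x\<close>, \<open>y\<close>, \<open>g\<close>,
    \<open>z\<close> is essential: extensionality is used twice, lifting \<open>x\<close> and
    \<open>y\<close> past the two fresh variables, while the closed term \<open>b\<close> is
    unchanged.\<close>
  have "LApp (LApp (LApp b (LApp (LApp b x) y)) g) z
      =\<^sub>\<beta>\<^sub>\<eta> LApp (LApp (LApp (LApp b (LApp b x)) (LApp b y)) g) z"
    if b: "b = to_lam B" for b x y g z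
  proof -
    note B1 = to_lam_B_app [folded b]
    have "LApp (LApp (LApp b (LApp (LApp b x) y)) g) z =\<^sub>\<beta>\<^sub>\<eta> LApp (LApp (LApp b x) y) (LApp g z)"
      by (rule B1)
    moreover have "\<dots> =\<^sub>\<beta>\<^sub>\<eta> LApp x (LApp y (LApp g z))"
      by (rule B1)
    moreover have "LApp (LApp (LApp (LApp b (LApp b x)) (LApp b y)) g) z
        =\<^sub>\<beta>\<^sub>\<eta> LApp (LApp (LApp b x) (LApp (LApp b y) g)) z"
      by (intro beta_eta_eq.app beta_eta_eq.refl B1)
    moreover have "\<dots> =\<^sub>\<beta>\<^sub>\<eta> LApp x (LApp (LApp (LApp b y) g) z)"
      by (rule B1)
    moreover have "\<dots> =\<^sub>\<beta>\<^sub>\<eta> LApp x (LApp y (LApp g z))"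
      by (intro beta_eta_eq.app beta_eta_eq.refl B1)
    ultimately show ?thesis
      by (meson beta_eta_eq.sym beta_eta_eq.trans)
  qed
  then show ?thesis
    by - (rule beta_eta_eq_ext [OF beta_eta_eq_ext], simp only: lift.simps(2) lift_to_lam)
qed

lemma B_derivable_imp_B_equivalent: "B_derivable s t \<Longrightarrow> B_equivalent s t"
  unfolding B_equivalent_def
proof (induction rule: B_derivable.induct)
  case (B1 x y z)
  show ?case
    unfolding to_lam.simps(2) by (rule to_lam_B_app)
next
  case (B2 x y)
  show ?case
    unfolding to_lam.simps(2) by (rule to_lam_B_comp)
next
  case (B3 x)
  \<comment> \<open>One extra argument suffices: B1 turns the left side into
    \<open>B (B f y)\<close> and the right side into \<open>B (B f) (B y)\<close>, which B2
    identifies.\<close>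
  have "LApp (LApp (LApp b b) (LApp b f)) y
      =\<^sub>\<beta>\<^sub>\<eta> LApp (LApp (LApp b (LApp b (LApp b f))) b) y"
    if b: "b = to_lam B" for b f y
  proof -
    note B1 = to_lam_B_app [folded b] and comp = to_lam_B_comp [folded b]
    have "LApp (LApp (LApp b b) (LApp b f)) y =\<^sub>\<beta>\<^sub>\<eta> LApp b (LApp (LApp b f) y)"
      by (rule B1)
    moreover have "\<dots> =\<^sub>\<beta>\<^sub>\<eta> LApp (LApp b (LApp b f)) (LApp b y)"
      by (rule comp)
    moreover have "LApp (LApp (LApp b (LApp b (LApp b f))) b) y =\<^sub>\<beta>\<^sub>\<eta> \<dots>"
      by (rule B1)
    ultimately show ?thesis
      by (blast intro: beta_eta_eq.sym beta_eta_eq.trans)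
  qed
  then show ?case
    unfolding to_lam.simps(2)
    by - (rule beta_eta_eq_ext, simp only: lift.simps(2) lift_to_lam)
qed (auto intro: beta_eta_eq.intros)

section \<open>Normal forms\<close>

primrec B_pow :: "nat \<Rightarrow> bterm" where
  "B_pow 0 = B"
| "B_pow (Suc n) = B \<cdot> B_pow n"

text \<open>Compositions associate to the right. The empty one would be the identity and has no
  clause, whence the hypotheses \<open>ns \<noteq> []\<close> below.\<close>

fun B_poly :: "nat list \<Rightarrow> bterm" where
  "B_poly [n] = B_pow n"
| "B_poly (n # ns) = B \<cdot> B_pow n \<cdot> B_poly ns"

section \<open>Composition and the exchange law\<close>

declare B_derivable.trans [trans] beta_eta_eq.trans [trans]

lemma B_derivable_comp:
  "B_derivable s s' \<Longrightarrow> B_derivable t t' \<Longrightarrow> B_derivable (B \<cdot> s \<cdot> t) (B \<cdot> s' \<cdot> t')"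
  by (intro B_derivable.cong B_derivable.refl)

text \<open>B2 rewrites the head \<open>B (B x y)\<close> to \<open>B (B x) (B y)\<close>; applied
  to \<open>z\<close>, this contracts by B1.\<close>

lemma B_derivable_comp_assoc:
  "B_derivable (B \<cdot> (B \<cdot> x \<cdot> y) \<cdot> z) (B \<cdot> x \<cdot> (B \<cdot> y \<cdot> z))"
  by (meson B_derivable.B1 B_derivable.B2 B_derivable.cong B_derivable.refl B_derivable.trans)

text \<open>For \<open>m = 0\<close> this is an instance of B3, as \<open>n > 0\<close>; B2 carries
  the law to larger \<open>m\<close> by distributing an outer \<open>B\<close> over the
  composition.\<close>

lemma B_derivable_swap_pow:
  "m < n \<Longrightarrow>
    B_derivable (B \<cdot> B_pow m \<cdot> B_pow n) (B \<cdot> B_pow (Suc n) \<cdot> B_pow m)"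
proof (induction m arbitrary: n)
  case 0
  then show ?case
    by (cases n) (auto intro: B_derivable.B3)
next
  case (Suc m)
  then obtain k where n: "n = Suc k" and "m < k"
    by (cases n) auto
  have "B_derivable (B \<cdot> B_pow (Suc m) \<cdot> B_pow n) (B \<cdot> (B \<cdot> B_pow m \<cdot> B_pow k))"
    using n by (auto intro: B_derivable.B2 B_derivable.sym)
  also have "B_derivable \<dots> (B \<cdot> (B \<cdot> B_pow n \<cdot> B_pow m))"
    using Suc.IH [OF \<open>m < k\<close>] n by (auto intro: B_derivable.cong B_derivable.refl)
  also have "B_derivable \<dots> (B \<cdot> B_pow (Suc n) \<cdot> B_pow (Suc m))"
    by (auto intro: B_derivable.B2)
  finally show ?case .
qed

text \<open>Each larger exponent that \<open>m\<close> passes is raised by one, as the exchange law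
  dictates.\<close>

fun insert_pow :: "nat \<Rightarrow> nat list \<Rightarrow> nat list" where
  "insert_pow m [] = [m]"
| "insert_pow m (n # ns) = (if m < n then Suc n # insert_pow m ns else m # n # ns)"

lemma B_poly_Cons: "ns \<noteq> [] \<Longrightarrow> B_poly (n # ns) = B \<cdot> B_pow n \<cdot> B_poly ns"
  by (cases ns) auto

lemma insert_pow_not_Nil [simp]: "insert_pow m ns \<noteq> []"
  by (cases ns) auto

lemma set_insert_pow: "k \<in> set (insert_pow m ns) \<Longrightarrow> k = m \<or> k \<in> set ns \<or> k - 1 \<in> set ns"
  by (induction ns) (auto split: if_splits)

text \<open>Passed entries grow by at most one, and any entry standing before them was passed too,
  so it has grown by exactly one.\<close>

lemma sorted_insert_pow:
  "sorted_wrt (\<ge>) ns \<Longrightarrow> sorted_wrt (\<ge>) (insert_pow m ns)"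
  by (induction ns) (fastforce dest!: set_insert_pow)+

lemma B_derivable_insert_pow:
  "ns \<noteq> [] \<Longrightarrow> B_derivable (B \<cdot> B_pow m \<cdot> B_poly ns) (B_poly (insert_pow m ns))"
proof (induction ns)
  case (Cons n ns)
  show ?case
  proof (cases "m < n")
    case False
    then show ?thesis
      by (simp add: B_derivable.refl)
  next
    case mn: True
    show ?thesis
    proof (cases "ns = []")
      case True
      with mn show ?thesis
        using B_derivable_swap_pow by simp
    next
      case False
      have "B_derivable (B \<cdot> B_pow m \<cdot> B_poly (n # ns)) (B \<cdot> (B \<cdot> B_pow m \<cdot> B_pow n) \<cdot> B_poly ns)"
        using False by (auto simp: B_poly_Cons intro: B_derivable_comp_assoc B_derivable.sym)
      also have "B_derivable \<dots> (B \<cdot> (B \<cdot> B_pow (Suc n) \<cdot> B_pow m) \<cdot> B_poly ns)"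
        by (intro B_derivable_comp B_derivable_swap_pow mn B_derivable.refl)
      also have "B_derivable \<dots> (B \<cdot> B_pow (Suc n) \<cdot> (B \<cdot> B_pow m \<cdot> B_poly ns))"
        by (rule B_derivable_comp_assoc)
      also have "B_derivable \<dots> (B \<cdot> B_pow (Suc n) \<cdot> B_poly (insert_pow m ns))"
        by (intro B_derivable_comp Cons.IH False B_derivable.refl)
      finally show ?thesis
        using mn by (simp add: B_poly_Cons del: B_pow.simps)
    qed
  qed
qed simp

lemma B_derivable_map_Suc:
  "ns \<noteq> [] \<Longrightarrow> B_derivable (B \<cdot> B_poly ns) (B_poly (map Suc ns))"
proof (induction ns)
  case (Cons n ns)
  show ?case
  proof (cases "ns = []")
    case True
    then show ?thesis
      by (simp add: B_derivable.refl)
  next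
    case False
    then have "B_derivable (B \<cdot> B_poly (n # ns)) (B \<cdot> B_pow (Suc n) \<cdot> (B \<cdot> B_poly ns))"
      by (auto simp: B_poly_Cons intro: B_derivable.B2)
    also have "B_derivable \<dots> (B \<cdot> B_pow (Suc n) \<cdot> B_poly (map Suc ns))"
      by (intro B_derivable_comp Cons.IH False B_derivable.refl)
    finally show ?thesis
      using False by (simp add: B_poly_Cons del: B_pow.simps)
  qed
qed simp

section \<open>Existence of normal forms\<close>

definition has_nf :: "bterm \<Rightarrow> bool" where
  "has_nf t \<longleftrightarrow> (\<exists>ns. ns \<noteq> [] \<and> sorted_wrt (\<ge>) ns \<and> B_derivable t (B_poly ns))"

lemma has_nf_derivable: "B_derivable s t \<Longrightarrow> has_nf t \<Longrightarrow> has_nf s"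
  unfolding has_nf_def by (blast intro: B_derivable.trans)

text \<open>For \<open>n = 0\<close>, applying \<open>B\<close> raises every exponent by one. For
  \<open>n = Suc m\<close>, the application \<open>B \<cdot> B_pow m \<cdot> t\<close> is already a
  composition, so \<open>m\<close> is inserted into the exponents of \<open>t\<close>.\<close>

lemma has_nf_pow_app:
  assumes "has_nf t"
  shows "has_nf (B_pow n \<cdot> t)"
proof -
  from assms obtain ns where ns: "ns \<noteq> []" "sorted_wrt (\<ge>) ns" "B_derivable t (B_poly ns)"
    unfolding has_nf_def by blast
  show ?thesis
  proof (cases n)
    case 0
    then have "B_derivable (B_pow n \<cdot> t) (B \<cdot> B_poly ns)"
      using ns by (auto intro: B_derivable.cong B_derivable.refl)
    also have "B_derivable \<dots> (B_poly (map Suc ns))"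
      using ns by (intro B_derivable_map_Suc)
    finally show ?thesis
      unfolding has_nf_def using ns by (intro exI [of _ "map Suc ns"]) (auto simp: sorted_wrt_map)
  next
    case (Suc m)
    then have "B_derivable (B_pow n \<cdot> t) (B \<cdot> B_pow m \<cdot> B_poly ns)"
      using ns by (auto intro: B_derivable.cong B_derivable.refl)
    also have "B_derivable \<dots> (B_poly (insert_pow m ns))"
      using ns by (intro B_derivable_insert_pow)
    finally show ?thesis
      unfolding has_nf_def using ns sorted_insert_pow insert_pow_not_Nil by blast
  qed
qed

text \<open>By B1, applying a composition means applying its factors in turn, the rightmost
  first.\<close>

lemma has_nf_poly_app: "ns \<noteq> [] \<Longrightarrow> has_nf t \<Longrightarrow> has_nf (B_poly ns \<cdot> t)"
proof (induction ns)
  case (Cons n ns)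
  then show ?case
    by (cases "ns = []")
      (auto simp: B_poly_Cons intro: has_nf_pow_app has_nf_derivable [OF B_derivable.B1])
qed simp

lemma has_nf: "has_nf t"
proof (induction t)
  case B
  then show ?case
    unfolding has_nf_def by (intro exI [of _ "[0]"]) (auto intro: B_derivable.refl)
next
  case (BApp s t)
  then obtain ns where "ns \<noteq> []" "B_derivable s (B_poly ns)"
    unfolding has_nf_def by blast
  with BApp show ?case
    by (meson has_nf_poly_app has_nf_derivable B_derivable.cong B_derivable.refl)
qed

section \<open>Uniqueness of normal forms\<close>

abbreviation apps :: "lam \<Rightarrow> lam list \<Rightarrow> lam" where
  "apps \<equiv> foldl LApp"

text \<open>The effect of \<open>B_pow n\<close> on the arguments after its first one, which becomes
  the head. Lists too short for a merge are returned with no merge made.\<close>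

fun merge_at :: "nat \<Rightarrow> lam list \<Rightarrow> lam list" where
  "merge_at 0 (a # b # us) = LApp a b # us"
| "merge_at (Suc n) (a # us) = a # merge_at n us"
| "merge_at _ us = us"

lemma apps_cong: "s =\<^sub>\<beta>\<^sub>\<eta> t \<Longrightarrow> apps s us =\<^sub>\<beta>\<^sub>\<eta> apps t us"
  by (induction us arbitrary: s t) (auto intro: beta_eta_eq.app beta_eta_eq.refl)

lemma apps_B_comp:
  "apps (to_lam (B \<cdot> s \<cdot> t)) (u # us) =\<^sub>\<beta>\<^sub>\<eta> apps (to_lam s) (LApp (to_lam t) u # us)"
  using apps_cong [OF to_lam_B_app, of "to_lam s" "to_lam t" u us] by simp

text \<open>An outer \<open>B\<close> makes \<open>u a\<close> the new head, so the position of the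
  merge is counted from the argument after \<open>a\<close>.\<close>

lemma apps_B_pow:
  "n + 2 \<le> length us \<Longrightarrow> apps (to_lam (B_pow n)) (u # us) =\<^sub>\<beta>\<^sub>\<eta> apps u (merge_at n us)"
proof (induction n us arbitrary: u rule: merge_at.induct)
  case (1 a b us)
  show ?case
    using apps_cong [OF to_lam_B_app, of u a b us] by simp
next
  case (2 n a us)
  have "apps (to_lam (B_pow (Suc n))) (u # a # us) =\<^sub>\<beta>\<^sub>\<eta> apps (to_lam (B_pow n)) (LApp u a # us)"
    using apps_cong [OF to_lam_B_app, of "to_lam (B_pow n)" u a us] by simp
  also have "\<dots> =\<^sub>\<beta>\<^sub>\<eta> apps (LApp u a) (merge_at n us)"
    using 2 by simp
  finally show ?case
    by simp
qed auto

lemma length_merge_at [simp]: "n + 2 \<le> length us \<Longrightarrow> length (merge_at n us) = length us - 1"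
  by (induction n us rule: merge_at.induct) auto

text \<open>The leftmost factor merges first, with the remaining composition applied to
  \<open>u\<close> as its head. Every merge shortens the list by one, hence \<open>length ns\<close>
  in the bound.\<close>

lemma apps_B_poly:
  "ns \<noteq> [] \<Longrightarrow> \<forall>n\<in>set ns. n + length ns < length us \<Longrightarrow>
    apps (to_lam (B_poly ns)) (u # us) =\<^sub>\<beta>\<^sub>\<eta> apps u (fold merge_at ns us)"
proof (induction ns arbitrary: us)
  case (Cons n ns)
  show ?case
  proof (cases "ns = []")
    case True
    with Cons.prems show ?thesis
      using apps_B_pow by simp
  next
    case False
    have len: "n + 2 \<le> length us"
      using Cons.prems False by (cases ns) auto
    have "apps (to_lam (B_poly (n # ns))) (u # us)
        =\<^sub>\<beta>\<^sub>\<eta> apps (to_lam (B_pow n)) (LApp (to_lam (B_poly ns)) u # us)"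
      unfolding B_poly_Cons [OF False] by (rule apps_B_comp)
    also have "\<dots> =\<^sub>\<beta>\<^sub>\<eta> apps (to_lam (B_poly ns)) (u # merge_at n us)"
      using apps_B_pow [OF len] by simp
    also have "\<dots> =\<^sub>\<beta>\<^sub>\<eta> apps u (fold merge_at ns (merge_at n us))"
      using Cons.prems False len by (intro Cons.IH) auto
    finally show ?thesis
      by simp
  qed
qed simp

section \<open>Recovering the exponents from a forest\<close>

lemma merge_at_nth_less: "i < n \<Longrightarrow> n + 2 \<le> length us \<Longrightarrow> merge_at n us ! i = us ! i"
  by (induction n us arbitrary: i rule: merge_at.induct) (auto simp: nth_Cons')

lemma merge_at_nth: "n + 2 \<le> length us \<Longrightarrow> merge_at n us ! n = LApp (us ! n) (us ! Suc n)"
  by (induction n us rule: merge_at.induct) auto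

text \<open>Once its position is known, a merge is undone by splitting the application found
  there.\<close>

lemma merge_at_inject:
  "merge_at n us = merge_at n vs \<Longrightarrow> n + 2 \<le> length us \<Longrightarrow> n + 2 \<le> length vs \<Longrightarrow> us = vs"
proof (induction n arbitrary: us vs)
  case 0
  then show ?case
    by (auto simp: numeral_2_eq_2 Suc_le_length_iff)
next
  case (Suc n)
  then show ?case
    by (cases us; cases vs) auto
qed

lemma length_fold_merge_at:
  "\<forall>n\<in>set ns. n + length ns < length us \<Longrightarrow> length (fold merge_at ns us) = length us - length ns"
proof (induction ns arbitrary: us)
  case (Cons n ns)
  then have "n + 2 \<le> length us"
    by auto
  moreover from this have "\<forall>m\<in>set ns. m + length ns < length (merge_at n us)"
    using Cons.prems by auto
  ultimately show ?case
    using Cons.IH [of "merge_at n us"] by auto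
qed simp

lemma fold_merge_at_nth_less:
  "\<forall>n\<in>set ns. i < n \<and> n + length ns < length us \<Longrightarrow> fold merge_at ns us ! i = us ! i"
proof (induction ns arbitrary: us)
  case (Cons n ns)
  have "n + 2 \<le> length us"
    using Cons.prems by (cases ns) auto
  moreover from this have "\<forall>m\<in>set ns. i < m \<and> m + length ns < length (merge_at n us)"
    using Cons.prems by auto
  ultimately show ?case
    using Cons.IH [of "merge_at n us"] Cons.prems by (auto simp: merge_at_nth_less)
qed simp

lemma abs_free_merge_at:
  "\<forall>u\<in>set us. abs_free u \<Longrightarrow> \<forall>u\<in>set (merge_at n us). abs_free u"
  by (induction n us rule: merge_at.induct) auto

lemma abs_free_fold_merge_at:
  "\<forall>u\<in>set us. abs_free u \<Longrightarrow> \<forall>u\<in>set (fold merge_at ns us). abs_free u"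
proof (induction ns arbitrary: us)
  case (Cons n ns)
  show ?case
    using Cons.IH [OF abs_free_merge_at [OF Cons.prems]] by simp
qed simp

lemma abs_free_apps: "abs_free (apps u us) \<longleftrightarrow> abs_free u \<and> (\<forall>v\<in>set us. abs_free v)"
  by (induction us arbitrary: u) auto

text \<open>A variable head is no application, so it marks where the spine ends.\<close>

lemma apps_LVar_inject: "apps (LVar i) us = apps (LVar i) vs \<longleftrightarrow> us = vs"
proof (induction us arbitrary: vs rule: rev_induct)
  case Nil
  show ?case
    by (cases vs rule: rev_cases) auto
next
  case (snoc u us)
  then show ?case
    by (cases vs rule: rev_cases) auto
qed

text \<open>The last exponent of a weakly decreasing list is the position of the leftmost application
  in the resulting forest, so the exponents can be read off one by one from the end.\<close>

lemma fold_merge_at_inject: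
  assumes "sorted_wrt (\<ge>) ns" "sorted_wrt (\<ge>) ms"
    and "\<forall>n\<in>set ns. n + length ns < N" "\<forall>m\<in>set ms. m + length ms < N"
    and "fold merge_at ns (replicate N (LVar i)) = fold merge_at ms (replicate N (LVar i))"
  shows "ns = ms"
  using assms
proof (induction ns arbitrary: ms rule: rev_induct)
  case Nil
  then show ?case
    using length_fold_merge_at [of ms "replicate N (LVar i)"] by (cases ms) auto
next
  case (snoc n ns)
  let ?F = "\<lambda>ks. fold merge_at ks (replicate N (LVar i))"
  have len: "k + 2 \<le> length (?F ks)" if "\<forall>j\<in>set (ks @ [k]). j + length (ks @ [k]) < N" for ks k
    using that length_fold_merge_at [of ks "replicate N (LVar i)"] by fastforce
  have not_LVar: "?F (ks @ [k]) ! k \<noteq> LVar i"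
    if "\<forall>j\<in>set (ks @ [k]). j + length (ks @ [k]) < N" for ks k
    using merge_at_nth [OF len [OF that]] by simp
  have LVar: "?F (ks @ [k]) ! j = LVar i"
    if "\<forall>j\<in>set (ks @ [k]). j + length (ks @ [k]) < N" "sorted_wrt (\<ge>) (ks @ [k])" "j < k" for ks k j
  proof -
    have "\<forall>l\<in>set (ks @ [k]). j < l \<and> l + length (ks @ [k]) < length (replicate N (LVar i))"
      using that by (fastforce simp: sorted_wrt_append)
    from fold_merge_at_nth_less [OF this] show ?thesis
      using that by simp
  qed
  have "ms \<noteq> []"
    using snoc.prems length_fold_merge_at [of "ns @ [n]" "replicate N (LVar i)"] by auto
  then obtain m ms' where ms: "ms = ms' @ [m]"
    by (metis rev_exhaust)
  note prems = snoc.prems [unfolded ms]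
  \<comment> \<open>Otherwise, at the smaller of the two positions one forest has an application and
    the other still a variable.\<close>
  have mn: "m = n"
    using LVar [OF prems(3,1)] LVar [OF prems(4,2)] not_LVar [OF prems(3)] not_LVar [OF prems(4)]
      prems(5) by (metis nat_neq_iff)
  then have "?F ns = ?F ms'"
    using prems(5) len [OF prems(3)] len [OF prems(4)] by (auto dest: merge_at_inject)
  then have "ns = ms'"
    using prems by (intro snoc.IH) (auto simp: sorted_wrt_append)
  with mn ms show ?case
    by simp
qed

lemma B_poly_inject:
  assumes "to_lam (B_poly ns) =\<^sub>\<beta>\<^sub>\<eta> to_lam (B_poly ms)"
    and "ns \<noteq> []" "sorted_wrt (\<ge>) ns" "ms \<noteq> []" "sorted_wrt (\<ge>) ms"
  shows "ns = ms"
proof -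
  \<comment> \<open>Large enough for the bounds of both lists at once, so that both terms receive
    the same arguments.\<close>
  define N where "N = Suc (sum_list ns + length ns + sum_list ms + length ms)"
  \<comment> \<open>Copies of a single variable suffice, since the exponents are read off from the
    positions of applications.\<close>
  define us where "us = replicate N (LVar 0)"
  have N: "\<forall>n\<in>set ns. n + length ns < N" "\<forall>m\<in>set ms. m + length ms < N"
    using member_le_sum_list [of _ ns] member_le_sum_list [of _ ms] unfolding N_def by fastforce+
  have free: "abs_free (apps (LVar 0) (fold merge_at ks us))" for ks
    using abs_free_fold_merge_at [of us ks] by (simp add: abs_free_apps us_def)
  have "apps (LVar 0) (fold merge_at ns us) =\<^sub>\<beta>\<^sub>\<eta> apps (to_lam (B_poly ns)) (LVar 0 # us)"
    using assms N by (intro beta_eta_eq.sym [OF apps_B_poly]) (auto simp: us_def)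
  also have "\<dots> =\<^sub>\<beta>\<^sub>\<eta> apps (to_lam (B_poly ms)) (LVar 0 # us)"
    by (rule apps_cong) (rule assms)
  also have "\<dots> =\<^sub>\<beta>\<^sub>\<eta> apps (LVar 0) (fold merge_at ms us)"
    using assms N by (intro apps_B_poly) (auto simp: us_def)
  finally have "apps (LVar 0) (fold merge_at ns us) = apps (LVar 0) (fold merge_at ms us)"
    by (rule beta_eta_eq_abs_free) (rule free)+
  then show ?thesis
    using fold_merge_at_inject assms N unfolding apps_LVar_inject us_def by blast
qed

theorem theorem2p1:
  fixes s t :: bterm
  shows "B_equivalent s t \<longleftrightarrow> B_derivable s t"
proof
  assume eq: "B_equivalent s t"
  obtain ns ms where ns: "ns \<noteq> []" "sorted_wrt (\<ge>) ns" "B_derivable s (B_poly ns)"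
    and ms: "ms \<noteq> []" "sorted_wrt (\<ge>) ms" "B_derivable t (B_poly ms)"
    using has_nf unfolding has_nf_def by meson
  \<comment> \<open>Soundness transfers the equivalence from \<open>s\<close> and \<open>t\<close>
    to their normal forms.\<close>
  have "B_equivalent (B_poly ns) (B_poly ms)"
    using eq ns(3) [THEN B_derivable_imp_B_equivalent] ms(3) [THEN B_derivable_imp_B_equivalent]
    unfolding B_equivalent_def by (meson beta_eta_eq.sym beta_eta_eq.trans)
  then have "ns = ms"
    using ns ms B_poly_inject unfolding B_equivalent_def by blast
  with ns ms show "B_derivable s t"
    by (meson B_derivable.sym B_derivable.trans)
qed (rule B_derivable_imp_B_equivalent)

end
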